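(* If $\kappa$ is a composability relation on observations, then the lifting $[\kappa]$ is a composability relation on TESs. Moreover, if $\kappa$ is symmetric, then $[\kappa]$ is symmetric.
   Context: $\mathbb{E}$ is a fixed universal set of events; $\mathbb{R}_+$ is the set of reals $\ge 0$; $\mathcal{P}$ is powerset. For $E\subseteq\mathbb{E}$, $\mathit{TES}(E)$ is the set of timed-event streams (TESs) over $E$: functions $\sigma:\mathbb{N}\to\mathcal{P}(E)\times\mathbb{R}_+$, $\sigma(i)=(O_i,t_i)$, such that $t_i<t_{i+1}$ for all $i$, and for every $n\in\mathbb{N}$ there is $i$ with $t_i>n$. The derivative $\sigma'$ of $\sigma$ is $\sigma'(i)=\sigma(i+1)$. A composability relation on TESs is a parametrized relation $R$ such that for all $E_1,E_2\subseteq\mathbb{E}$, $R(E_1,E_2)\subseteq \mathit{TES}(E_1)\times \mathit{TES}(E_2)$. A composability relation on observations is a parametrized relation $\kappa$ such that for all $E_1,E_2\subseteq\mathbb{E}$, $\kappa(E_1,E_2)\subseteq(\mathcal{P}(E_1)\times\mathbb{R}_+)\times(\mathcal{P}(E_2)\times\mathbb{R}_+)$. A parametrized relation $Q$ is symmetric if for all $(x_1,x_2)$ and all $(X_1,X_2)$: $(x_1,x_2)\in Q(X_1,X_2)\iff(x_2,x_1)\in Q(X_2,X_1)$. For $\mathcal{R}\subseteq \mathit{TES}(\mathbb{E})^2$, $\Phi_\kappa(E_1,E_2)(\mathcal{R})$ is the set of pairs $(\tau_1,\tau_2)\in \mathit{TES}(\mathbb{E})^2$ such that $(\tau_1(0),\tau_2(0))\in\kappa(E_1,E_2)$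 and, with $t_1,t_2$ the time stamps of $\tau_1(0),\tau_2(0)$ respectively, one of the following holds: $t_1<t_2$ and $(\tau_1',\tau_2)\in\mathcal{R}$; or $t_2<t_1$ and $(\tau_1,\tau_2')\in\mathcal{R}$; or $t_1=t_2$ and $(\tau_1',\tau_2')\in\mathcal{R}$. The lifting $[\kappa]$ is the parametrized relation given by the greatest fixed point: $[\kappa](E_1,E_2)=\bigcup\{\mathcal{R}\subseteq \mathit{TES}(\mathbb{E})\times \mathit{TES}(\mathbb{E})\mid\mathcal{R}\subseteq\Phi_\kappa(E_1,E_2)(\mathcal{R})\}$. *)

theory Defs
  imports Complex_Main
begin

(* The fixed universal set of events is the type 'e; as a set it is UNIV. *)

type_synonym 'e obs = "'e set \<times> real"

type_synonym 'e stream_of_obs = "nat \<Rightarrow> 'e obs"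

type_synonym ('e, 'x) param_rel = "'e set \<Rightarrow> 'e set \<Rightarrow> ('x \<times> 'x) set"

definition Obs :: "'e set \<Rightarrow> 'e obs set" where
  "Obs E = Pow E \<times> {0..}"

definition TES :: "'e set \<Rightarrow> 'e stream_of_obs set" where
  "TES E = {\<sigma>. (\<forall>i. \<sigma> i \<in> Obs E) \<and>
                (\<forall>i. snd (\<sigma> i) < snd (\<sigma> (Suc i))) \<and>
                (\<forall>n::nat. \<exists>i. snd (\<sigma> i) > real n)}"

definition derivative :: "'e stream_of_obs \<Rightarrow> 'e stream_of_obs" where
  "derivative \<sigma> = (\<lambda>i. \<sigma> (Suc i))"

definition composability_on_TES :: "('e, 'e stream_of_obs) param_rel \<Rightarrow> bool" where
  "composability_on_TES R \<longleftrightarrow> (\<forall>E\<^sub>1 E\<^sub>2. R E\<^sub>1 E\<^sub>2 \<subseteq> TES E\<^sub>1 \<times> TES E\<^sub>2)"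

definition composability_on_obs :: "('e, 'e obs) param_rel \<Rightarrow> bool" where
  "composability_on_obs \<kappa> \<longleftrightarrow> (\<forall>E\<^sub>1 E\<^sub>2. \<kappa> E\<^sub>1 E\<^sub>2 \<subseteq> Obs E\<^sub>1 \<times> Obs E\<^sub>2)"

definition param_symmetric :: "('e, 'x) param_rel \<Rightarrow> bool" where
  "param_symmetric Q \<longleftrightarrow>
     (\<forall>x\<^sub>1 x\<^sub>2 X\<^sub>1 X\<^sub>2. (x\<^sub>1, x\<^sub>2) \<in> Q X\<^sub>1 X\<^sub>2 \<longleftrightarrow> (x\<^sub>2, x\<^sub>1) \<in> Q X\<^sub>2 X\<^sub>1)"

definition Phi ::
  "('e, 'e obs) param_rel \<Rightarrow> 'e set \<Rightarrow> 'e set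
     \<Rightarrow> ('e stream_of_obs \<times> 'e stream_of_obs) set \<Rightarrow> ('e stream_of_obs \<times> 'e stream_of_obs) set" where
  "Phi \<kappa> E\<^sub>1 E\<^sub>2 \<R> =
     {(\<tau>\<^sub>1, \<tau>\<^sub>2) \<in> TES UNIV \<times> TES UNIV.
        (\<tau>\<^sub>1 0, \<tau>\<^sub>2 0) \<in> \<kappa> E\<^sub>1 E\<^sub>2 \<and>
        (snd (\<tau>\<^sub>1 0) < snd (\<tau>\<^sub>2 0) \<and> (derivative \<tau>\<^sub>1, \<tau>\<^sub>2) \<in> \<R> \<or>
         snd (\<tau>\<^sub>2 0) < snd (\<tau>\<^sub>1 0) \<and> (\<tau>\<^sub>1, derivative \<tau>\<^sub>2) \<in> \<R> \<or>
         snd (\<tau>\<^sub>1 0) = snd (\<tau>\<^sub>2 0) \<and> (derivative \<tau>\<^sub>1, derivative \<tau>\<^sub>2) \<in> \<R>)}"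

definition lift_rel :: "('e, 'e obs) param_rel \<Rightarrow> ('e, 'e stream_of_obs) param_rel" where
  "lift_rel \<kappa> E\<^sub>1 E\<^sub>2 =
     \<Union>{\<R>. \<R> \<subseteq> TES UNIV \<times> TES UNIV \<and> \<R> \<subseteq> Phi \<kappa> E\<^sub>1 E\<^sub>2 \<R>}"

lemma Phi_subset: "Phi \<kappa> E\<^sub>1 E\<^sub>2 \<R> \<subseteq> TES UNIV \<times> TES UNIV"
  by (auto simp: Phi_def)

lemma mono_Phi: "mono (Phi \<kappa> E\<^sub>1 E\<^sub>2)"
  by (rule monoI) (auto simp: Phi_def)

lemma lift_rel_eq_gfp: "lift_rel \<kappa> E\<^sub>1 E\<^sub>2 = gfp (Phi \<kappa> E\<^sub>1 E\<^sub>2)"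
proof -
  have "{\<R>. \<R> \<subseteq> TES UNIV \<times> TES UNIV \<and> \<R> \<subseteq> Phi \<kappa> E\<^sub>1 E\<^sub>2 \<R>} = {\<R>. \<R> \<subseteq> Phi \<kappa> E\<^sub>1 E\<^sub>2 \<R>}"
    using Phi_subset by blast
  then show ?thesis
    by (simp add: lift_rel_def gfp_def)
qed

end

theory Submission
  imports Defs
begin

text \<open>
  A pair in the lifting can always be unfolded until its first component has moved on by one
  observation: time stamps of the second component are unbounded, so only finitely many unfoldings
  can leave the first component in place. Hence every observation of the first component appears at
  the head of some related pair, where membership in \<open>\<kappa>\<close> bounds its events. The second component
  and symmetry follow because lifting commutes with taking converses.
\<close>

lemma lift_rel_unfold: "lift_rel \<kappa> E\<^sub>1 E\<^sub>2 = Phi \<kappa> E\<^sub>1 E\<^sub>2 (lift_rel \<kappa> E\<^sub>1 E\<^sub>2)"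
  unfolding lift_rel_eq_gfp by (rule gfp_unfold[OF mono_Phi])

lemma lift_rel_TES:
  assumes "(\<sigma>, \<tau>) \<in> lift_rel \<kappa> E\<^sub>1 E\<^sub>2"
  shows "\<sigma> \<in> TES UNIV" "\<tau> \<in> TES UNIV"
  using assms unfolding lift_rel_def by auto

lemma lift_rel_head:
  assumes "(\<sigma>, \<tau>) \<in> lift_rel \<kappa> E\<^sub>1 E\<^sub>2"
  shows "(\<sigma> 0, \<tau> 0) \<in> \<kappa> E\<^sub>1 E\<^sub>2"
  using assms by (subst (asm) lift_rel_unfold) (simp add: Phi_def)

lemma lift_rel_step:
  assumes "(\<sigma>, \<tau>) \<in> lift_rel \<kappa> E\<^sub>1 E\<^sub>2"
  shows "snd (\<sigma> 0) < snd (\<tau> 0) \<and> (derivative \<sigma>, \<tau>) \<in> lift_rel \<kappa> E\<^sub>1 E\<^sub>2 \<or>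
    snd (\<tau> 0) < snd (\<sigma> 0) \<and> (\<sigma>, derivative \<tau>) \<in> lift_rel \<kappa> E\<^sub>1 E\<^sub>2 \<or>
    snd (\<sigma> 0) = snd (\<tau> 0) \<and> (derivative \<sigma>, derivative \<tau>) \<in> lift_rel \<kappa> E\<^sub>1 E\<^sub>2"
  using assms by (subst (asm) lift_rel_unfold) (simp add: Phi_def)

text \<open>Induction on the index \<open>n\<close> of an observation of \<open>\<tau>\<close> no
  earlier than \<open>\<sigma> 0\<close>: an unfolding that leaves \<open>\<sigma>\<close> in place
  passes to \<open>derivative \<tau>\<close>, which lowers this index by one.\<close>

lemma lift_rel_advance:
  assumes "(\<sigma>, \<tau>) \<in> lift_rel \<kappa> E\<^sub>1 E\<^sub>2"
  shows "\<exists>\<tau>'. (derivative \<sigma>, \<tau>') \<in> lift_rel \<kappa> E\<^sub>1 E\<^sub>2"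
proof -
  \<comment> \<open>Unboundedness in \<open>TES\<close> is stated for natural bounds only, hence the
    detour through \<open>k\<close>.\<close>
  obtain k :: nat where "snd (\<sigma> 0) \<le> real k"
    using real_arch_simple by blast
  moreover obtain n where "real k < snd (\<tau> n)"
    using lift_rel_TES(2)[OF assms] unfolding TES_def by blast
  ultimately have "snd (\<sigma> 0) \<le> snd (\<tau> n)"
    by linarith
  then show ?thesis
    using assms
  proof (induction n arbitrary: \<tau>)
    \<comment> \<open>Here \<open>\<tau> 0\<close> is not earlier than \<open>\<sigma> 0\<close>, so
      the case that moves \<open>\<tau>\<close> alone is impossible.\<close>
    case 0
    then show ?case
      using lift_rel_step[OF 0(2)] by auto
  next
    case (Suc n)
    then have "snd (\<sigma> 0) \<le> snd (derivative \<tau> n)"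
      by (simp add: derivative_def)
    with Suc.IH lift_rel_step[OF Suc.prems(2)] show ?case
      by blast
  qed
qed

lemma lift_rel_drop:
  assumes "(\<sigma>, \<tau>) \<in> lift_rel \<kappa> E\<^sub>1 E\<^sub>2"
  shows "\<exists>\<tau>'. ((\<lambda>j. \<sigma> (i + j)), \<tau>') \<in> lift_rel \<kappa> E\<^sub>1 E\<^sub>2"
proof (induction i)
  case 0
  show ?case
    using assms by auto
next
  case (Suc i)
  then show ?case
    using lift_rel_advance by (fastforce simp: derivative_def)
qed

text \<open>The assumption constrains first components alone, so that the lemma applies both to
  \<open>\<kappa>\<close> and to its converse.\<close>

lemma lift_rel_fst_TES:
  assumes "\<kappa> E\<^sub>1 E\<^sub>2 \<subseteq> Obs E\<^sub>1 \<times> UNIV" and "(\<sigma>, \<tau>) \<in> lift_rel \<kappa> E\<^sub>1 E\<^sub>2"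
  shows "\<sigma> \<in> TES E\<^sub>1"
proof -
  have "\<sigma> i \<in> Obs E\<^sub>1" for i
  proof -
    obtain \<tau>' where "((\<lambda>j. \<sigma> (i + j)), \<tau>') \<in> lift_rel \<kappa> E\<^sub>1 E\<^sub>2"
      using lift_rel_drop[OF assms(2)] by blast
    from lift_rel_head[OF this] show ?thesis
      using assms(1) by auto
  qed
  \<comment> \<open>The conditions on time stamps do not mention the event set and carry over from
    \<open>TES UNIV\<close>.\<close>
  then show ?thesis
    using lift_rel_TES(1)[OF assms(2)] by (simp add: TES_def)
qed

text \<open>Swapping the streams exchanges the two strict cases of \<open>Phi\<close> and preserves
  the case of equal time stamps.\<close>

lemma Phi_converse: "(Phi \<kappa> E\<^sub>1 E\<^sub>2 \<R>)\<inverse> = Phi (\<lambda>A B. (\<kappa> B A)\<inverse>) E\<^sub>2 E\<^sub>1 (\<R>\<inverse>)"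
  unfolding Phi_def by auto

text \<open>Coinduction: the converse of the lifting is a post-fixed point of the \<open>Phi\<close>
  on the right.\<close>

lemma lift_rel_converse_le: "(lift_rel \<kappa> E\<^sub>1 E\<^sub>2)\<inverse> \<subseteq> lift_rel (\<lambda>A B. (\<kappa> B A)\<inverse>) E\<^sub>2 E\<^sub>1"
proof -
  have "(lift_rel \<kappa> E\<^sub>1 E\<^sub>2)\<inverse> \<subseteq> Phi (\<lambda>A B. (\<kappa> B A)\<inverse>) E\<^sub>2 E\<^sub>1 ((lift_rel \<kappa> E\<^sub>1 E\<^sub>2)\<inverse>)"
    using lift_rel_unfold Phi_converse by blast
  then show ?thesis
    unfolding lift_rel_eq_gfp[of "\<lambda>A B. (\<kappa> B A)\<inverse>"] by (rule gfp_upperbound)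
qed

theorem lemma4:
  fixes \<kappa> :: "('e, 'e obs) param_rel"
  assumes "composability_on_obs \<kappa>"
  shows "composability_on_TES (lift_rel \<kappa>) \<and>
    (param_symmetric \<kappa> \<longrightarrow> param_symmetric (lift_rel \<kappa>))"
proof (intro conjI impI)
  have obs: "\<kappa> E\<^sub>1 E\<^sub>2 \<subseteq> Obs E\<^sub>1 \<times> Obs E\<^sub>2" for E\<^sub>1 E\<^sub>2
    using assms by (simp add: composability_on_obs_def)
  show "composability_on_TES (lift_rel \<kappa>)"
    unfolding composability_on_TES_def
  proof (intro allI subrelI SigmaI)
    fix E\<^sub>1 E\<^sub>2 \<sigma> \<tau>
    assume rel: "(\<sigma>, \<tau>) \<in> lift_rel \<kappa> E\<^sub>1 E\<^sub>2"
    show "\<sigma> \<in> TES E\<^sub>1"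
      using lift_rel_fst_TES[OF _ rel] obs by blast
    have "(\<tau>, \<sigma>) \<in> lift_rel (\<lambda>A B. (\<kappa> B A)\<inverse>) E\<^sub>2 E\<^sub>1"
      using rel lift_rel_converse_le by blast
    moreover have "(\<kappa> E\<^sub>1 E\<^sub>2)\<inverse> \<subseteq> Obs E\<^sub>2 \<times> UNIV"
      using obs by blast
    ultimately show "\<tau> \<in> TES E\<^sub>2"
      by (intro lift_rel_fst_TES[where \<kappa> = "\<lambda>A B. (\<kappa> B A)\<inverse>"])
  qed
next
  assume "param_symmetric \<kappa>"
  then have "(\<lambda>A B. (\<kappa> B A)\<inverse>) = \<kappa>"
    unfolding param_symmetric_def by (intro ext) auto
  then have "(lift_rel \<kappa> E\<^sub>1 E\<^sub>2)\<inverse> \<subseteq> lift_rel \<kappa> E\<^sub>2 E\<^sub>1" for E\<^sub>1 E\<^sub>2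
    using lift_rel_converse_le[of \<kappa>] by simp
  \<comment> \<open>The inclusion holds for every pair of event sets, so exchanging them gives the
    other direction.\<close>
  then show "param_symmetric (lift_rel \<kappa>)"
    unfolding param_symmetric_def by blast
qed

end
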